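(* Let $(X,C)$ and $(Y,K)$ be Archimedean partially ordered vector spaces, let $U\subseteq X$ and $V\subseteq Y$ be upper sets, and let $f\colon U\to V$ be an order-isomorphism. If $(X,C)$ is directed and $C$ equals the inf-sup hull (in $X$) of $[0,\infty)_{\mathcal{R}_E}$, the set of finite sums of engaged extreme vectors of $C$, then $f$ is affine.
   Context: A partially ordered vector space $(X,C)$ is a real vector space $X$ with a cone $C$ ($C$ convex, $\lambda C\subseteq C$ for $\lambda\ge 0$, $C\cap(-C)=\{0\}$), ordered by $x\le y$ iff $y-x\in C$. It is Archimedean if, whenever $x\in X$, $y\in C$ and $nx\le y$ for all integers $n\ge1$, then $x\le 0$. It is directed if any two elements of $X$ have a common upper bound in $X$ (equivalently $X=C-C$). A set $U\subseteq X$ is an upper set if $x\in U$ and $y\ge x$ imply $y\in U$. An order-isomorphism is an order preserving bijection whose inverse is also order preserving (subsets carry the induced order). A map $f\colon U\to Y$ on an upper set $U$ is affine if it is the restriction of an affine map (a translate of a linear map) $F\colon \mathrm{aff}(U)\to Y$. A vector $e\in C\setminus\{0\}$ is an extreme vector of $C$ if $0\le x\le e$ implies $x=\lambda e$ for some $\lambda\ge 0$; then $R_e=\{\lambda e\colon\lambda\ge0\}$ is an extreme ray. Let $\mathcal{R}$ be the collection of all extreme rays of $C$. A ray $R\in\mathcal{R}$ is engaged if $R\subseteq \mathrm{span}\{s\colon s\in S,\ S\in\mathcal{R}\setminus\{R\}\}$; $\mathcal{R}_E$ is the collection of engaged extreme rays, and an extreme vector $e\in C$ is engaged if $R_e\in\mathcal{R}_E$.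 Put $[0,\infty)_{\mathcal{R}_E}=\{r_1+\cdots+r_n\colon r_i\in C \text{ an engaged extreme vector for } i=1,\dots,n\}$. The inf-sup hull of $V\subseteq X$ is the set of all $x\in X$ for which there are index sets $A,B$ and elements $v_{\alpha,\beta}\in V$ ($\alpha\in A,\beta\in B$) with $x=\inf_{\alpha\in A}(\sup_{\beta\in B}v_{\alpha,\beta})$ (all these suprema and the infimum existing in $X$). *)

theory Defs
  imports "HOL-Analysis.Analysis" "HOL-Library.Lub_Glb"
begin

text \<open>
  A partially ordered vector space \<open>(X, C)\<close> is a type of class
  \<^class>\<open>ordered_real_vector\<close>, with cone \<open>C = {0..}\<close>: the class axioms say exactly that
  \<open>x \<le> y \<longleftrightarrow> y - x \<in> C\<close> for a convex set \<open>C\<close> that is closed under multiplication by nonnegative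
  reals and satisfies \<open>C \<inter> - C = {0}\<close>.
\<close>

class archimedean_ordered_real_vector = ordered_real_vector +
  assumes archimedean: "0 \<le> y \<Longrightarrow> (\<And>n::nat. 1 \<le> n \<Longrightarrow> real n *\<^sub>R x \<le> y) \<Longrightarrow> x \<le> 0"

definition directed_order :: "'a::ordered_real_vector itself \<Rightarrow> bool" where
  "directed_order _ \<longleftrightarrow> (\<forall>x y::'a. \<exists>z. x \<le> z \<and> y \<le> z)"

definition upper_set :: "'a::order set \<Rightarrow> bool" where
  "upper_set U \<longleftrightarrow> (\<forall>x\<in>U. \<forall>y. x \<le> y \<longrightarrow> y \<in> U)"

definition order_isomorphism_on ::
  "'a::order set \<Rightarrow> 'b::order set \<Rightarrow> ('a \<Rightarrow> 'b) \<Rightarrow> bool" where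
  "order_isomorphism_on U V f \<longleftrightarrow>
     bij_betw f U V \<and> mono_on U f \<and> mono_on V (inv_into U f)"

text \<open>
  A linear map on the direction space of an affine subspace extends to the whole space, so in the
  following definition \<open>T\<close> may be taken to be linear on the whole type.
\<close>

definition affine_map_on :: "'a::real_vector set \<Rightarrow> ('a \<Rightarrow> 'b::real_vector) \<Rightarrow> bool" where
  "affine_map_on S F \<longleftrightarrow> (\<exists>T c. linear T \<and> (\<forall>x\<in>S. F x = T x + c))"

definition is_affine_on :: "'a::real_vector set \<Rightarrow> ('a \<Rightarrow> 'b::real_vector) \<Rightarrow> bool" where
  "is_affine_on U f \<longleftrightarrow> (\<exists>F. affine_map_on (affine hull U) F \<and> (\<forall>x\<in>U. f x = F x))"

definition extreme_vector :: "'a::ordered_real_vector \<Rightarrow> bool" where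
  "extreme_vector e \<longleftrightarrow> 0 \<le> e \<and> e \<noteq> 0 \<and>
     (\<forall>x. 0 \<le> x \<and> x \<le> e \<longrightarrow> (\<exists>c::real. 0 \<le> c \<and> x = c *\<^sub>R e))"

definition ray :: "'a::real_vector \<Rightarrow> 'a set" where
  "ray e = {c *\<^sub>R e | c::real. 0 \<le> c}"

definition extreme_rays :: "'a::ordered_real_vector set set" where
  "extreme_rays = {ray e | e. extreme_vector e}"

definition engaged_rays :: "'a::ordered_real_vector set set" where
  "engaged_rays = {R \<in> extreme_rays. R \<subseteq> span (\<Union> (extreme_rays - {R}))}"

definition engaged_vector :: "'a::ordered_real_vector \<Rightarrow> bool" where
  "engaged_vector e \<longleftrightarrow> extreme_vector e \<and> ray e \<in> engaged_rays"

text \<open>The empty sum (\<open>n = 0\<close>) is included.\<close>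

definition engaged_sums :: "'a::ordered_real_vector set" where
  "engaged_sums = {(\<Sum>i=1..n. r i) | (n::nat) r. \<forall>i\<in>{1..n}. engaged_vector (r i)}"

text \<open>
  Index sets cannot range over all types inside a definition. The index types chosen here suffice:
  the lemma below shows that families indexed by arbitrary types give no further points.
\<close>

definition inf_sup_hull :: "'a::order set \<Rightarrow> 'a set" where
  "inf_sup_hull V =
     {x. \<exists>(A::'a set set) (B::'a set) (v::'a set \<Rightarrow> 'a \<Rightarrow> 'a) s.
           (\<forall>\<alpha>\<in>A. \<forall>\<beta>\<in>B. v \<alpha> \<beta> \<in> V) \<and>
           (\<forall>\<alpha>\<in>A. isLub UNIV (v \<alpha> ` B) (s \<alpha>)) \<and>
           isGlb UNIV (s ` A) x}"

lemma inf_sup_hullI: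
  fixes A :: "'i set" and B :: "'j set" and v :: "'i \<Rightarrow> 'j \<Rightarrow> 'a::order"
  assumes v: "\<And>\<alpha> \<beta>. \<alpha> \<in> A \<Longrightarrow> \<beta> \<in> B \<Longrightarrow> v \<alpha> \<beta> \<in> V"
    and s: "\<And>\<alpha>. \<alpha> \<in> A \<Longrightarrow> isLub UNIV (v \<alpha> ` B) (s \<alpha>)"
    and x: "isGlb UNIV (s ` A) x"
  shows "x \<in> inf_sup_hull V"
proof -
  define A' where "A' = (\<lambda>\<alpha>. v \<alpha> ` B) ` A"
  define B' where "B' = (if B = {} then {} else V)"
  define v' where "v' = (\<lambda>(S::'a set) b. if b \<in> S then b else (SOME c. c \<in> S))"
  define s' where "s' = (\<lambda>S::'a set. THE y. isLub UNIV S y)"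
  have img: "v' S ` B' = S" if "S \<in> A'" for S
  proof -
    from that obtain \<alpha> where \<alpha>: "\<alpha> \<in> A" "S = v \<alpha> ` B" by (auto simp: A'_def)
    show ?thesis
    proof (cases "B = {}")
      case True
      then show ?thesis using \<alpha> by (simp add: B'_def)
    next
      case False
      then have "S \<noteq> {}" "S \<subseteq> V" using \<alpha> v by auto
      then have "v' S b \<in> S" for b by (auto simp: v'_def some_in_eq)
      moreover have "v' S b = b" if "b \<in> S" for b using that by (simp add: v'_def)
      ultimately show ?thesis using False \<open>S \<subseteq> V\<close> by (force simp: B'_def)
    qed
  qed
  have s': "s' (v \<alpha> ` B) = s \<alpha>" if "\<alpha> \<in> A" for \<alpha>
    unfolding s'_def using s[OF that]
    by (intro the_equality antisym) (auto intro: isLub_le_isUb isLub_isUb)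
  have "v' S b \<in> V" if "S \<in> A'" "b \<in> B'" for S b
  proof -
    have "v' S b \<in> S" using img[OF that(1)] that(2) by blast
    then show ?thesis using that(1) v by (auto simp: A'_def)
  qed
  moreover have "isLub UNIV (v' S ` B') (s' S)" if "S \<in> A'" for S
    using img[OF that] that s s' by (auto simp: A'_def)
  moreover have "s' ` A' = s ` A" using s' by (force simp: A'_def)
  ultimately have "(\<forall>\<alpha>\<in>A'. \<forall>\<beta>\<in>B'. v' \<alpha> \<beta> \<in> V) \<and>
      (\<forall>\<alpha>\<in>A'. isLub UNIV (v' \<alpha> ` B') (s' \<alpha>)) \<and> isGlb UNIV (s' ` A') x"
    using x by simp
  then show ?thesis unfolding inf_sup_hull_def by blast
qed

end

theory Submission
  imports Defs
begin

text \<open>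
  By the Archimedean property, a totally ordered interval \<open>{0..y}\<close> lies on a ray. Hence \<open>f\<close> maps each
  half-line in an extreme direction onto such a half-line. For non-parallel extreme vectors \<open>a\<close>, \<open>b\<close>
  the image of \<open>{x + s a + t b | s t. s \<ge> 0, t \<ge> 0}\<close> is doubly ruled by half-lines in extreme directions.
  Among three rulings of one family the middle direction is a limit of nonnegative combinations
  of the outer two, so it is parallel to one of them; this makes the image flat, that is, the increment
  \<open>f (x + a) - f x\<close> does not change when \<open>x\<close> is replaced by \<open>x + b\<close>. If \<open>a\<close> is engaged, then also \<open>b\<close>
  parallel to \<open>a\<close> is allowed, because \<open>b\<close> is a combination of other extreme vectors. Suprema and infima
  are compatible with \<open>f\<close>, which extends this independence of the base point to all increments by
  elements of the cone. So the increment is an additive positive function on the cone, hence linear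
  by the Archimedean property.
\<close>

section \<open>Archimedean ordered vector spaces\<close>

lemma archimedean_le_zero:
  fixes x y :: "'a::archimedean_ordered_real_vector"
  assumes "0 \<le> y" and le: "\<And>r::real. 0 < r \<Longrightarrow> x \<le> r *\<^sub>R y"
  shows "x \<le> 0"
proof (rule archimedean[OF \<open>0 \<le> y\<close>])
  fix n :: nat assume n: "1 \<le> n"
  have "real n *\<^sub>R x \<le> real n *\<^sub>R ((1 / real n) *\<^sub>R y)"
    using n by (intro scaleR_left_mono le) auto
  then show "real n *\<^sub>R x \<le> y" using n by simp
qed

lemma archimedean_le:
  fixes x y z :: "'a::archimedean_ordered_real_vector"
  assumes "0 \<le> y" and le: "\<And>r::real. 0 < r \<Longrightarrow> x \<le> z + r *\<^sub>R y"
  shows "x \<le> z"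
proof -
  have "x - z \<le> 0"
    using assms by (intro archimedean_le_zero[of y]) (simp_all add: algebra_simps)
  then show ?thesis by simp
qed

text \<open>Take for \<open>c\<close> the supremum of the \<open>t\<close> in the unit interval with
  \<open>t *\<^sub>R y\<close> below \<open>z\<close>. Both \<open>c *\<^sub>R y \<le> z\<close> and
  the converse hold up to an error \<open>r *\<^sub>R y\<close>, which the Archimedean property
  removes.\<close>

lemma chain_interval_multiple:
  fixes y z :: "'a::archimedean_ordered_real_vector"
  assumes y: "0 \<le> y"
    and chain: "\<And>a b. \<lbrakk>0 \<le> a; a \<le> y; 0 \<le> b; b \<le> y\<rbrakk> \<Longrightarrow> a \<le> b \<or> b \<le> a"
    and z: "0 \<le> z" "z \<le> y"
  shows "\<exists>c::real. 0 \<le> c \<and> z = c *\<^sub>R y"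
proof -
  define S where "S = {t::real. 0 \<le> t \<and> t \<le> 1 \<and> t *\<^sub>R y \<le> z}"
  define c where "c = Sup S"
  have S0: "0 \<in> S" using z by (simp add: S_def)
  have bdd: "bdd_above S" by (auto simp: S_def bdd_above_def)
  have c0: "0 \<le> c" unfolding c_def by (rule cSup_upper[OF S0 bdd])
  have "c *\<^sub>R y \<le> z"
  proof (rule archimedean_le[OF y])
    fix r :: real assume "0 < r"
    then obtain t where t: "t \<in> S" "c - r < t"
      using less_cSup_iff[of S "c - r"] S0 bdd unfolding c_def by auto
    have "c *\<^sub>R y \<le> (t + r) *\<^sub>R y" using t y by (intro scaleR_right_mono) auto
    also have "\<dots> \<le> z + r *\<^sub>R y" using t by (simp add: S_def scaleR_add_left)
    finally show "c *\<^sub>R y \<le> z + r *\<^sub>R y" .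
  qed
  moreover have "z \<le> c *\<^sub>R y"
  proof (rule archimedean_le[OF y])
    fix r :: real assume r: "0 < r"
    have "z \<le> (c + r) *\<^sub>R y"
    proof (cases "c + r \<le> 1")
      case True
      \<comment> \<open>Just beyond the supremum the multiple of \<open>y\<close> is no longer below
        \<open>z\<close>, so comparability puts it above \<open>z\<close>.\<close>
      have "c + r \<notin> S" using cSup_upper[OF _ bdd, of "c + r"] r by (auto simp: c_def)
      then have *: "\<not> (c + r) *\<^sub>R y \<le> z" using True c0 r by (auto simp: S_def)
      have "0 \<le> (c + r) *\<^sub>R y" using c0 r y by (intro scaleR_nonneg_nonneg) auto
      moreover have "(c + r) *\<^sub>R y \<le> y" using scaleR_right_mono[OF True y] by simp
      ultimately show ?thesis using chain[of "(c + r) *\<^sub>R y" z] z * by blast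
    next
      case False
      then have "1 *\<^sub>R y \<le> (c + r) *\<^sub>R y" using y by (intro scaleR_right_mono) auto
      then show ?thesis using z by simp
    qed
    then show "z \<le> c *\<^sub>R y + r *\<^sub>R y" by (simp add: scaleR_add_left)
  qed
  ultimately show ?thesis using c0 by (auto intro: antisym)
qed

text \<open>Directedness writes every vector as a difference of cone elements, and additivity makes
  the resulting extension well defined. Positivity makes it monotone, which upgrades homogeneity
  from integers to reals.\<close>

lemma additive_cone_map_extends:
  fixes h :: "'a::ordered_real_vector \<Rightarrow> 'b::archimedean_ordered_real_vector"
  assumes dir: "directed_order TYPE('a)"
    and add: "\<And>v w. 0 \<le> v \<Longrightarrow> 0 \<le> w \<Longrightarrow> h (v + w) = h v + h w"
    and pos: "\<And>v. 0 \<le> v \<Longrightarrow> 0 \<le> h v"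
  shows "\<exists>T. linear T \<and> (\<forall>v\<ge>0. T v = h v)"
proof -
  define p where "p = (\<lambda>v::'a. SOME p. 0 \<le> p \<and> v \<le> p)"
  define T where "T = (\<lambda>v. h (p v) - h (p v - v))"
  have p: "0 \<le> p v \<and> v \<le> p v" for v
  proof -
    obtain q where "0 \<le> q \<and> v \<le> q" using dir unfolding directed_order_def by blast
    then show ?thesis unfolding p_def by (rule someI)
  qed
  \<comment> \<open>The value does not depend on the chosen bound \<open>p v\<close>; additivity of
    \<open>T\<close> needs this for the bound \<open>p v + p w\<close>.\<close>
  have T: "T v = h q - h (q - v)" if "0 \<le> q" "v \<le> q" for q v
  proof -
    have "h (p v) + h (q - v) = h (p v + (q - v))" using p that by (intro add[symmetric]) auto
    also have "\<dots> = h (q + (p v - v))" by (simp add: algebra_simps)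
    also have "\<dots> = h q + h (p v - v)" using p that by (intro add) auto
    finally show ?thesis by (simp add: T_def algebra_simps)
  qed
  have h0: "h 0 = 0" using add[of 0 0] by simp
  have Th: "T v = h v" if "0 \<le> v" for v using T[of v v] that h0 by simp
  have Tadd: "T (v + w) = T v + T w" for v w
  proof -
    have "T (v + w) = h (p v + p w) - h ((p v - v) + (p w - w))"
      using T[of "p v + p w" "v + w"] p by (simp add: add_mono algebra_simps)
    also have "\<dots> = (h (p v) + h (p w)) - (h (p v - v) + h (p w - w))"
      using p by (simp add: add)
    finally show ?thesis by (simp add: T_def)
  qed
  have T0: "T 0 = 0" using Tadd[of 0 0] by simp
  have Tdiff: "T (v - w) = T v - T w" for v w using Tadd[of "v - w" w] by simp
  have Tmono: "T v \<le> T w" if "v \<le> w" for v w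
  proof -
    have "0 \<le> T (w - v)" using Th pos that by simp
    then show ?thesis by (simp add: Tdiff)
  qed
  have Tnat: "T (real n *\<^sub>R v) = real n *\<^sub>R T v" for n v
    by (induction n) (simp_all add: T0 Tadd scaleR_add_left)
  have Tpos: "T (t *\<^sub>R v) = t *\<^sub>R T v" if t: "0 \<le> t" and v: "0 \<le> v" for t v
  proof -
    have Tv: "0 \<le> T v" using Th pos v by simp
    have bounds: "real n *\<^sub>R (T (t *\<^sub>R v) - t *\<^sub>R T v) \<le> T v
        \<and> real n *\<^sub>R (t *\<^sub>R T v - T (t *\<^sub>R v)) \<le> T v" for n
    proof -
      \<comment> \<open>Since \<open>real n * t\<close> lies between the integers \<open>m\<close>
        and \<open>m + 1\<close>, monotonicity confines the homogeneity defect, multiplied by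
        \<open>n\<close>, to at most \<open>T v\<close>.\<close>
      define m where "m = nat \<lfloor>real n * t\<rfloor>"
      have m: "real m \<le> real n * t" "real n * t \<le> real (Suc m)"
        using t by (simp_all add: m_def, linarith)
      have eq: "real n *\<^sub>R T (t *\<^sub>R v) = T ((real n * t) *\<^sub>R v)"
        by (simp flip: Tnat)
      have "T ((real n * t) *\<^sub>R v) \<le> T (real (Suc m) *\<^sub>R v)"
        using m v by (intro Tmono scaleR_right_mono)
      also have "\<dots> = real (Suc m) *\<^sub>R T v" by (rule Tnat)
      also have "\<dots> \<le> (real n * t + 1) *\<^sub>R T v" using m Tv by (intro scaleR_right_mono) auto
      finally have 1: "real n *\<^sub>R T (t *\<^sub>R v) \<le> (real n * t) *\<^sub>R T v + T v"
        by (simp add: eq scaleR_add_left)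
      have "(real n * t) *\<^sub>R T v \<le> (real m + 1) *\<^sub>R T v"
        using m Tv by (intro scaleR_right_mono) auto
      also have "\<dots> = T (real m *\<^sub>R v) + T v" by (simp add: Tnat scaleR_add_left)
      also have "\<dots> \<le> T ((real n * t) *\<^sub>R v) + T v"
        using m v by (intro add_right_mono Tmono scaleR_right_mono)
      finally have 2: "(real n * t) *\<^sub>R T v \<le> real n *\<^sub>R T (t *\<^sub>R v) + T v"
        by (simp add: eq)
      show ?thesis using 1 2 by (simp add: scaleR_diff_right algebra_simps)
    qed
    have "T (t *\<^sub>R v) - t *\<^sub>R T v \<le> 0" "t *\<^sub>R T v - T (t *\<^sub>R v) \<le> 0"
      using bounds by (blast intro: archimedean[OF Tv])+
    then show ?thesis by simp
  qed
  have Tpos': "T (t *\<^sub>R v) = t *\<^sub>R T v" if t: "0 \<le> t" for t v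
  proof -
    have "T (t *\<^sub>R v) = T (t *\<^sub>R p v) - T (t *\<^sub>R (p v - v))"
      by (simp flip: Tdiff add: scaleR_diff_right)
    also have "\<dots> = t *\<^sub>R T (p v) - t *\<^sub>R T (p v - v)" using p t by (simp add: Tpos)
    finally show ?thesis by (simp add: Tdiff scaleR_diff_right)
  qed
  have "linear T"
  proof (rule linearI)
    show "T (t *\<^sub>R v) = t *\<^sub>R T v" for t v
    proof (cases "0 \<le> t")
      case False
      then have "T ((- t) *\<^sub>R v) = (- t) *\<^sub>R T v" by (intro Tpos') auto
      then show ?thesis using Tdiff[of 0 "t *\<^sub>R v"] T0 by simp
    qed (rule Tpos')
  qed (rule Tadd)
  then show ?thesis using Th by blast
qed

section \<open>Parallel extreme vectors\<close>

text \<open>The strictly positive factor makes the relation symmetric; for extreme vectors it says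
  that they span the same ray.\<close>

definition parallel :: "'a::real_vector \<Rightarrow> 'a \<Rightarrow> bool" where
  "parallel u w \<longleftrightarrow> (\<exists>c>0. u = c *\<^sub>R w)"

lemma parallelI: "0 < c \<Longrightarrow> u = c *\<^sub>R w \<Longrightarrow> parallel u w"
  by (auto simp: parallel_def)

lemma parallel_sym: "parallel u w \<Longrightarrow> parallel w u"
  unfolding parallel_def by (metis inverse_positive_iff_positive scaleR_one scaleR_scaleR
      left_inverse less_irrefl)

lemma parallel_trans: "parallel u v \<Longrightarrow> parallel v w \<Longrightarrow> parallel u w"
  unfolding parallel_def by (metis mult_pos_pos scaleR_scaleR)

lemma parallel_ray_eq: "parallel u w \<Longrightarrow> ray u = ray w"
proof -
  have "ray u \<subseteq> ray w" if "parallel u w" for u w :: 'a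
    using that by (auto simp: ray_def parallel_def intro: exI[of _ "_ * _"])
  then show "parallel u w \<Longrightarrow> ray u = ray w" using parallel_sym by blast
qed

lemma extreme_vector_nonneg: "extreme_vector e \<Longrightarrow> 0 \<le> e"
  by (simp add: extreme_vector_def)

lemma extreme_vector_not_le_zero: "extreme_vector e \<Longrightarrow> \<not> e \<le> 0"
  using antisym by (auto simp: extreme_vector_def)

lemma extreme_vector_le:
  assumes "extreme_vector e" "0 \<le> x" "x \<noteq> 0" "x \<le> e"
  shows "parallel x e"
proof -
  obtain c where "0 \<le> c" "x = c *\<^sub>R e" using assms by (auto simp: extreme_vector_def)
  then show ?thesis using \<open>x \<noteq> 0\<close> by (cases "c = 0") (auto intro: parallelI[of c])
qed

lemma extreme_vector_le_multiple:
  assumes e: "extreme_vector e" and x: "0 \<le> x" "x \<noteq> 0" "x \<le> c *\<^sub>R e"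
  shows "parallel x e"
proof -
  have c: "0 < c"
  proof (rule ccontr)
    assume "\<not> 0 < c"
    then have "c *\<^sub>R e \<le> 0 *\<^sub>R e"
      using extreme_vector_nonneg[OF e] by (intro scaleR_right_mono) auto
    then show False using x antisym[of x 0] by simp
  qed
  have "inverse c *\<^sub>R x \<le> inverse c *\<^sub>R (c *\<^sub>R e)"
    using c x by (intro scaleR_left_mono) auto
  then have "parallel (inverse c *\<^sub>R x) e"
    using c x by (intro extreme_vector_le[OF e]) (auto intro: scaleR_nonneg_nonneg)
  moreover have "parallel x (inverse c *\<^sub>R x)" using c by (intro parallelI[of c]) auto
  ultimately show ?thesis by (rule parallel_trans[rotated])
qed

lemma extreme_vector_scaleR:
  assumes e: "extreme_vector e" and t: "0 < t"
  shows "extreme_vector (t *\<^sub>R e)"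
  unfolding extreme_vector_def
proof (intro conjI allI impI)
  show "0 \<le> t *\<^sub>R e" "t *\<^sub>R e \<noteq> 0"
    using assms by (auto simp: extreme_vector_def intro: scaleR_nonneg_nonneg)
  fix x assume x: "0 \<le> x \<and> x \<le> t *\<^sub>R e"
  show "\<exists>c\<ge>0. x = c *\<^sub>R t *\<^sub>R e"
  proof (cases "x = 0")
    case False
    then have "parallel x e" using extreme_vector_le_multiple[OF e] x by blast
    then obtain c where "0 < c" "x = c *\<^sub>R e" by (auto simp: parallel_def)
    then show ?thesis using t by (intro exI[of _ "c / t"]) auto
  qed auto
qed

text \<open>Otherwise \<open>c - c' = d - d'\<close> would be a nonzero vector that is comparable with \<open>0\<close>,
  which forces \<open>d\<close> and \<open>d'\<close>, and then also \<open>c\<close> and \<open>d\<close>, to be parallel.\<close>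

lemma extreme_parallelogram:
  assumes ext: "extreme_vector c" "extreme_vector d" "extreme_vector d'"
    and eq: "c + d' = d + c'" and npar: "\<not> parallel c d" and par: "parallel c' c"
  shows "c' = c"
proof (rule ccontr)
  assume ne: "c' \<noteq> c"
  obtain k where k: "0 < k" "c' = k *\<^sub>R c" using par by (auto simp: parallel_def)
  have d': "d' = d + (k - 1) *\<^sub>R c" using eq k by (simp add: algebra_simps)
  have c0: "0 \<le> c" "c \<noteq> 0" using ext by (auto simp: extreme_vector_def)
  have "k < 1 \<or> k > 1" using ne k by (cases "k = 1") auto
  then show False
  proof
    assume k1: "k > 1"
    have "(k - 1) *\<^sub>R c \<ge> 0" using k1 c0 by (intro scaleR_nonneg_nonneg) auto
    then have "parallel d d'"
      using ext d' extreme_vector_le[of d' d] by (simp add: extreme_vector_def)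
    then have "parallel d' d" by (rule parallel_sym)
    then obtain m where m: "0 < m" "d' = m *\<^sub>R d" by (auto simp: parallel_def)
    have "(k - 1) *\<^sub>R c = (m - 1) *\<^sub>R d" using d' m by (simp add: algebra_simps)
    then have "inverse (k - 1) *\<^sub>R ((k - 1) *\<^sub>R c) = inverse (k - 1) *\<^sub>R ((m - 1) *\<^sub>R d)" by simp
    then have "c \<le> (inverse (k - 1) * (m - 1)) *\<^sub>R d" using k1 by simp
    then show False using npar c0 extreme_vector_le_multiple[OF ext(2)] by blast
  next
    assume k1: "k < 1"
    have "(1 - k) *\<^sub>R c \<ge> 0" using k1 c0 by (intro scaleR_nonneg_nonneg) auto
    moreover have d: "d = d' + (1 - k) *\<^sub>R c" using d' by (simp add: algebra_simps)
    ultimately have "(1 - k) *\<^sub>R c \<le> d"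
      using ext by (metis add_increasing extreme_vector_nonneg order_refl)
    then have "inverse (1 - k) *\<^sub>R ((1 - k) *\<^sub>R c) \<le> inverse (1 - k) *\<^sub>R d"
      using k1 by (intro scaleR_left_mono) auto
    then have "c \<le> inverse (1 - k) *\<^sub>R d" using k1 by simp
    then show False using npar c0 extreme_vector_le_multiple[OF ext(2)] by blast
  qed
qed

text \<open>If coefficients \<open>p \<ge> t\<close> occurred for arbitrarily small errors, the
  Archimedean property would give \<open>t *\<^sub>R a \<le> b\<close>, and extremality of
  \<open>b\<close> would make the two parallel. The bound covers all \<open>r' \<le> r\<close>, so
  that two such radii can be replaced by their minimum.\<close>

lemma extreme_multiple_small:
  fixes a b y :: "'a::archimedean_ordered_real_vector"
  assumes ext: "extreme_vector a" "extreme_vector b" and npar: "\<not> parallel a b"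
    and y: "0 \<le> y" and t: "0 < t"
  shows "\<exists>r>0. \<forall>p r'. r' \<le> r \<longrightarrow> p *\<^sub>R a \<le> b + r' *\<^sub>R y \<longrightarrow> p < (t::real)"
proof (rule ccontr)
  assume contra: "\<not> ?thesis"
  have "t *\<^sub>R a \<le> b"
  proof (rule archimedean_le[OF y])
    fix r :: real assume "0 < r"
    then obtain p r' where p: "r' \<le> r" "p *\<^sub>R a \<le> b + r' *\<^sub>R y" "t \<le> p"
      using contra by (meson not_less)
    have "t *\<^sub>R a \<le> p *\<^sub>R a" using p ext by (intro scaleR_right_mono extreme_vector_nonneg)
    also note p(2)
    also have "b + r' *\<^sub>R y \<le> b + r *\<^sub>R y" using p y by (intro add_left_mono scaleR_right_mono)
    finally show "t *\<^sub>R a \<le> b + r *\<^sub>R y" .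
  qed
  moreover have "extreme_vector (t *\<^sub>R a)" using ext t by (intro extreme_vector_scaleR)
  ultimately have "parallel (t *\<^sub>R a) b"
    using ext by (intro extreme_vector_le) (auto simp: extreme_vector_def)
  moreover have "parallel a (t *\<^sub>R a)" using t by (intro parallelI[of "inverse t"]) auto
  ultimately show False using npar parallel_trans by blast
qed

text \<open>If neither outer vector were parallel to \<open>c1\<close>, both coefficients would
  become arbitrarily small with the error, forcing \<open>c1 \<le> 0\<close>.\<close>

lemma extreme_approx_combination_parallel:
  fixes c0 c1 c2 y :: "'a::archimedean_ordered_real_vector"
  assumes ext: "extreme_vector c0" "extreme_vector c1" "extreme_vector c2" and y: "0 \<le> y"
    and approx: "\<And>r::real. 0 < r \<Longrightarrow> \<exists>p q. c1 \<le> p *\<^sub>R c0 + q *\<^sub>R c2 + r *\<^sub>R y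
      \<and> p *\<^sub>R c0 \<le> c1 + r *\<^sub>R y \<and> q *\<^sub>R c2 \<le> c1 + r *\<^sub>R y"
  shows "parallel c0 c1 \<or> parallel c2 c1"
proof (rule ccontr)
  assume "\<not> ?thesis"
  then have npar: "\<not> parallel c0 c1" "\<not> parallel c2 c1" by auto
  have nonneg: "0 \<le> c0" "0 \<le> c2" using ext by (auto simp: extreme_vector_nonneg)
  have "c1 \<le> 0"
  proof (rule archimedean_le_zero)
    show "0 \<le> c0 + c2 + y" using nonneg y by simp
    fix t :: real assume t: "0 < t"
    obtain r where r: "r > 0" "\<And>p r'. r' \<le> r \<Longrightarrow> p *\<^sub>R c0 \<le> c1 + r' *\<^sub>R y \<Longrightarrow> p < t"
      using extreme_multiple_small[OF ext(1,2) npar(1) y t] by blast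
    obtain s where s: "s > 0" "\<And>p r'. r' \<le> s \<Longrightarrow> p *\<^sub>R c2 \<le> c1 + r' *\<^sub>R y \<Longrightarrow> p < t"
      using extreme_multiple_small[OF ext(3,2) npar(2) y t] by blast
    \<comment> \<open>One error size bounds both coefficients by \<open>t\<close> and also keeps the
      \<open>y\<close> term below \<open>t *\<^sub>R y\<close>.\<close>
    define u where "u = min t (min r s)"
    have u: "0 < u" "u \<le> t" "u \<le> r" "u \<le> s" using r s t by (auto simp: u_def)
    obtain p q where pq: "c1 \<le> p *\<^sub>R c0 + q *\<^sub>R c2 + u *\<^sub>R y"
      "p *\<^sub>R c0 \<le> c1 + u *\<^sub>R y" "q *\<^sub>R c2 \<le> c1 + u *\<^sub>R y"
      using approx[OF u(1)] by blast
    have "p < t" "q < t" using r(2)[OF u(3) pq(2)] s(2)[OF u(4) pq(3)] by auto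
    have "p *\<^sub>R c0 + q *\<^sub>R c2 + u *\<^sub>R y \<le> t *\<^sub>R c0 + t *\<^sub>R c2 + t *\<^sub>R y"
      using nonneg y u \<open>p < t\<close> \<open>q < t\<close> by (intro add_mono scaleR_right_mono) auto
    then show "c1 \<le> t *\<^sub>R (c0 + c2 + y)" using pq by (simp add: scaleR_add_right)
  qed
  then show False using ext extreme_vector_not_le_zero by blast
qed

section \<open>Increments of an order isomorphism\<close>

text \<open>The inverse \<open>g\<close> is a parameter, so the setting is symmetric: every fact
  about \<open>f\<close> transfers to \<open>g\<close> by interpreting the locale with the roles
  exchanged.\<close>

locale upper_iso =
  fixes U :: "'a::archimedean_ordered_real_vector set"
    and V :: "'b::archimedean_ordered_real_vector set"
    and f :: "'a \<Rightarrow> 'b" and g :: "'b \<Rightarrow> 'a"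
  assumes upper_U: "upper_set U" and upper_V: "upper_set V"
    and f_in: "\<And>x. x \<in> U \<Longrightarrow> f x \<in> V" and g_in: "\<And>y. y \<in> V \<Longrightarrow> g y \<in> U"
    and gf: "\<And>x. x \<in> U \<Longrightarrow> g (f x) = x" and fg: "\<And>y. y \<in> V \<Longrightarrow> f (g y) = y"
    and f_mono: "\<And>x x'. \<lbrakk>x \<in> U; x' \<in> U; x \<le> x'\<rbrakk> \<Longrightarrow> f x \<le> f x'"
    and g_mono: "\<And>y y'. \<lbrakk>y \<in> V; y' \<in> V; y \<le> y'\<rbrakk> \<Longrightarrow> g y \<le> g y'"
begin

lemma inverse_upper_iso: "upper_iso V U g f"
  by unfold_locales (fact upper_U upper_V f_in g_in gf fg f_mono g_mono)+

lemma U_up: "x \<in> U \<Longrightarrow> x \<le> x' \<Longrightarrow> x' \<in> U"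
  using upper_U by (auto simp: upper_set_def)

lemma V_up: "y \<in> V \<Longrightarrow> y \<le> y' \<Longrightarrow> y' \<in> V"
  using upper_V by (auto simp: upper_set_def)

lemma U_add: "x \<in> U \<Longrightarrow> 0 \<le> v \<Longrightarrow> x + v \<in> U"
  by (erule U_up) simp

lemma f_le_iff: "x \<in> U \<Longrightarrow> x' \<in> U \<Longrightarrow> f x \<le> f x' \<longleftrightarrow> x \<le> x'"
  using f_mono g_mono gf f_in by metis

lemma f_eq_iff: "x \<in> U \<Longrightarrow> x' \<in> U \<Longrightarrow> f x = f x' \<longleftrightarrow> x = x'"
  using gf by metis

definition incr :: "'a \<Rightarrow> 'a \<Rightarrow> 'b" where
  "incr x v = f (x + v) - f x"

lemma f_add: "f (x + v) = f x + incr x v"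
  by (simp add: incr_def)

lemma incr_zero [simp]: "incr x 0 = 0"
  by (simp add: incr_def)

lemma incr_add: "incr x (v + w) = incr x v + incr (x + v) w"
  by (simp add: incr_def add.assoc)

lemma incr_mono: "\<lbrakk>x \<in> U; 0 \<le> v; v \<le> w\<rbrakk> \<Longrightarrow> incr x v \<le> incr x w"
  unfolding incr_def by (intro diff_right_mono f_mono U_add add_left_mono) auto

lemma incr_nonneg: "\<lbrakk>x \<in> U; 0 \<le> v\<rbrakk> \<Longrightarrow> 0 \<le> incr x v"
  using incr_mono[of x 0 v] by simp

text \<open>The order interval from \<open>x\<close> to \<open>x + e\<close> is a chain because
  \<open>e\<close> is extreme, and \<open>f\<close> maps it onto the interval from
  \<open>f x\<close> to \<open>f x + incr x e\<close>. So \<open>chain_interval_multiple\<close>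
  applies to \<open>incr x e\<close>.\<close>

lemma extreme_incr:
  assumes x: "x \<in> U" and e: "extreme_vector e"
  shows "extreme_vector (incr x e)"
proof -
  have e0: "0 \<le> e" "e \<noteq> 0" using e by (auto simp: extreme_vector_def)
  have nonneg: "0 \<le> incr x e" using x e0 by (intro incr_nonneg)
  have chain: "a \<le> b \<or> b \<le> a" if ab: "0 \<le> a" "a \<le> incr x e" "0 \<le> b" "b \<le> incr x e" for a b
  proof -
    have *: "\<exists>s\<ge>0. f (x + s *\<^sub>R e) = f x + c" if c: "0 \<le> c" "c \<le> incr x e" for c
    proof -
      have cV: "f x + c \<in> V" using V_up[OF f_in[OF x]] c by simp
      have "x \<le> g (f x + c)" using g_mono[OF f_in[OF x] cV] gf[OF x] c by simp
      moreover have "g (f x + c) \<le> x + e"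
        using g_mono[OF cV f_in[OF U_add[OF x e0(1)]]] gf[OF U_add[OF x e0(1)]] c
        by (simp add: f_add)
      ultimately obtain s where "0 \<le> s" "g (f x + c) - x = s *\<^sub>R e"
        using e unfolding extreme_vector_def
        by (metis diff_ge_0_iff_ge diff_le_eq add.commute)
      then show ?thesis using fg[OF cV] by (metis add.commute diff_add_cancel)
    qed
    obtain s t where st: "0 \<le> s" "f (x + s *\<^sub>R e) = f x + a"
      "0 \<le> t" "f (x + t *\<^sub>R e) = f x + b"
      using *[OF ab(1,2)] *[OF ab(3,4)] by blast
    have "s *\<^sub>R e \<le> t *\<^sub>R e \<or> t *\<^sub>R e \<le> s *\<^sub>R e"
      using e0 by (meson linear scaleR_right_mono)
    moreover have "x + s *\<^sub>R e \<in> U" "x + t *\<^sub>R e \<in> U"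
      using x e0 st by (auto intro!: U_add scaleR_nonneg_nonneg)
    ultimately have "f (x + s *\<^sub>R e) \<le> f (x + t *\<^sub>R e) \<or> f (x + t *\<^sub>R e) \<le> f (x + s *\<^sub>R e)"
      by (simp add: f_le_iff)
    then show ?thesis by (simp add: st)
  qed
  moreover have "incr x e \<noteq> 0"
    using f_eq_iff[of "x + e" x] U_add x e0 by (simp add: incr_def)
  ultimately show ?thesis
    unfolding extreme_vector_def using nonneg chain_interval_multiple[OF nonneg] by blast
qed

lemma incr_parallel_le:
  assumes x: "x \<in> U" and ext: "extreme_vector d" "extreme_vector e" and le: "d \<le> e"
  shows "parallel (incr x d) (incr x e)"
proof (rule extreme_vector_le)
  show "extreme_vector (incr x e)" using x ext by (intro extreme_incr)
  show "incr x d \<le> incr x e" using x ext le by (intro incr_mono extreme_vector_nonneg)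
  show "0 \<le> incr x d" "incr x d \<noteq> 0"
    using extreme_incr[OF x ext(1)] by (auto simp: extreme_vector_def)
qed

text \<open>Parallel extreme vectors are comparable, so one increment lies below the other, which is
  extreme.\<close>

lemma incr_parallel:
  assumes x: "x \<in> U" and ext: "extreme_vector d" "extreme_vector e" and par: "parallel d e"
  shows "parallel (incr x d) (incr x e)"
proof -
  obtain c where c: "0 < c" "d = c *\<^sub>R e" using par by (auto simp: parallel_def)
  have e0: "0 \<le> e" using ext by (simp add: extreme_vector_nonneg)
  show ?thesis
  proof (cases "c \<le> 1")
    case True
    then show ?thesis
      using scaleR_right_mono[OF True e0] c by (intro incr_parallel_le x ext) simp
  next
    case False
    then have "1 *\<^sub>R e \<le> d" unfolding c by (intro scaleR_right_mono e0) auto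
    then show ?thesis using incr_parallel_le[OF x ext(2,1)] by (simp add: parallel_sym)
  qed
qed

text \<open>This is \<open>incr_parallel\<close> for the inverse, whose increment from
  \<open>f x\<close> takes \<open>incr x v\<close> back to \<open>v\<close>.\<close>

lemma parallel_incrD:
  assumes x: "x \<in> U" and ext: "extreme_vector d" "extreme_vector e"
    and par: "parallel (incr x d) (incr x e)"
  shows "parallel d e"
proof -
  interpret inv: upper_iso V U g f by (rule inverse_upper_iso)
  have "inv.incr (f x) (incr x v) = v" if "extreme_vector v" for v
    using that x by (simp add: inv.incr_def gf U_add extreme_vector_nonneg flip: f_add)
  then show ?thesis
    using inv.incr_parallel[OF f_in[OF x] extreme_incr[OF x ext(1)] extreme_incr[OF x ext(2)] par]
      ext by simp
qed

text \<open>The image of a half-line is a whole half-line: the inverse sends the multiple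
  \<open>d\<close> of \<open>incr x e\<close> to a multiple of \<open>e\<close>, which provides
  \<open>s\<close>.\<close>

lemma incr_surj:
  assumes x: "x \<in> U" and e: "extreme_vector e" and t: "0 < t"
  shows "\<exists>s>0. incr x (s *\<^sub>R e) = t *\<^sub>R incr x e"
proof -
  interpret inv: upper_iso V U g f by (rule inverse_upper_iso)
  define d where "d = t *\<^sub>R incr x e"
  have ext: "extreme_vector (incr x e)" by (rule extreme_incr[OF x e])
  have d: "extreme_vector d" unfolding d_def by (rule extreme_vector_scaleR[OF ext t])
  have "parallel d (incr x e)" using t by (auto simp: d_def intro: parallelI)
  then have "parallel (inv.incr (f x) d) (inv.incr (f x) (incr x e))"
    using f_in[OF x] d ext by (intro inv.incr_parallel)
  moreover have "inv.incr (f x) (incr x e) = e"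
    using x e by (simp add: inv.incr_def gf U_add extreme_vector_nonneg flip: f_add)
  ultimately obtain s where s: "0 < s" "inv.incr (f x) d = s *\<^sub>R e" by (auto simp: parallel_def)
  have "g (f x + d) = x + s *\<^sub>R e" using s x by (simp add: inv.incr_def gf algebra_simps)
  then have "f (x + s *\<^sub>R e) = f x + d"
    using fg[of "f x + d"] inv.U_add[OF f_in[OF x]] d by (simp add: extreme_vector_nonneg)
  then show ?thesis using s by (auto simp: incr_def d_def)
qed

lemma incr_half_line:
  assumes "x \<in> U" and "extreme_vector e" and "0 < s"
  shows "\<exists>k>0. incr x (s *\<^sub>R e) = k *\<^sub>R incr x e"
  using incr_parallel[OF assms(1) extreme_vector_scaleR[OF assms(2,3)] assms(2)
      parallelI[OF assms(3) refl]]
  by (simp add: parallel_def)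

text \<open>The points \<open>x\<close>, \<open>x + e\<close> and \<open>x + e + e\<close> lie on
  one half-line, so their images do too.\<close>

lemma incr_shift_parallel:
  assumes x: "x \<in> U" and e: "extreme_vector e"
  shows "parallel (incr (x + e) e) (incr x e)"
proof -
  have eU: "x + e \<in> U" using U_add[OF x] e by (simp add: extreme_vector_nonneg)
  have "0 < (2::real)" by simp
  from incr_half_line[OF x e this] obtain k where k: "incr x (e + e) = k *\<^sub>R incr x e"
    by (auto simp: scaleR_2)
  then have "incr (x + e) e \<le> (k - 1) *\<^sub>R incr x e"
    by (simp add: incr_add algebra_simps)
  then show ?thesis
    using extreme_incr[OF eU e] extreme_incr[OF x e]
    by (intro extreme_vector_le_multiple) (auto simp: extreme_vector_def)
qed

text \<open>The images of \<open>x\<close>, \<open>x + a\<close>, \<open>x + b\<close> and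
  \<open>x + a + b\<close> form a quadrilateral with extreme sides; one pair of parallel opposite
  sides already makes it a parallelogram.\<close>

lemma incr_parallelogram:
  assumes x: "x \<in> U" and ext: "extreme_vector a" "extreme_vector b" and npar: "\<not> parallel a b"
    and par: "parallel (incr (x + b) a) (incr x a)"
  shows "incr (x + b) a = incr x a"
proof (rule extreme_parallelogram)
  have "x + a \<in> U" using U_add[OF x] ext by (simp add: extreme_vector_nonneg)
  then show "extreme_vector (incr x a)" "extreme_vector (incr x b)"
    "extreme_vector (incr (x + a) b)"
    using x ext by (auto intro: extreme_incr)
  show "incr x a + incr (x + a) b = incr x b + incr (x + b) a"
    by (simp add: incr_def algebra_simps)
  show "\<not> parallel (incr x a) (incr x b)" using parallel_incrD[OF x ext] npar by blast
qed (fact par)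

text \<open>The half-line from \<open>x + s *\<^sub>R a\<close> in direction \<open>b\<close> is mapped into a half-line, so
  \<open>f (x + s *\<^sub>R a + b)\<close> is a convex combination of \<open>f (x + s *\<^sub>R a)\<close> and \<open>f (x + s *\<^sub>R a + 2 *\<^sub>R b)\<close>.
  Letting \<open>s\<close> grow exhibits the direction of the middle of the three image half-lines as
  a limit of nonnegative combinations of the outer two.\<close>

lemma incr_three_lines:
  assumes x: "x \<in> U" and ext: "extreme_vector a" "extreme_vector b"
  shows "parallel (incr x a) (incr (x + b) a) \<or> parallel (incr (x + b + b) a) (incr (x + b) a)"
proof -
  have b0: "0 \<le> b" using ext by (simp add: extreme_vector_nonneg)
  have xb: "x + b \<in> U" "x + b + b \<in> U" using x b0 by (auto intro: U_add)
  define c0 where "c0 = incr x a"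
  define c1 where "c1 = incr (x + b) a"
  define c2 where "c2 = incr (x + b + b) a"
  define y where "y = incr x (b + b)"
  have y0: "0 \<le> y" unfolding y_def using x b0 by (intro incr_nonneg) auto
  have yb: "incr x b \<le> y" unfolding y_def using x b0 by (intro incr_mono) auto
  have bb: "0 \<le> incr x b" using x b0 by (intro incr_nonneg)
  have ec: "extreme_vector c0" "extreme_vector c1" "extreme_vector c2"
    using x xb ext by (auto simp: c0_def c1_def c2_def intro: extreme_incr)
  have "\<exists>p q. c1 \<le> p *\<^sub>R c0 + q *\<^sub>R c2 + r *\<^sub>R y
      \<and> p *\<^sub>R c0 \<le> c1 + r *\<^sub>R y \<and> q *\<^sub>R c2 \<le> c1 + r *\<^sub>R y" if r: "0 < r" for r
  proof -
    \<comment> \<open>With this \<open>s\<close>, multiplying the final identity by \<open>r\<close>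
      gives \<open>c1\<close> coefficient one, while the fixed terms \<open>incr x b\<close> and
      \<open>y\<close> shrink to errors of at most \<open>r *\<^sub>R y\<close>.\<close>
    obtain s where s: "s > 0" "incr (x + b) (s *\<^sub>R a) = inverse r *\<^sub>R c1"
      using incr_surj[OF xb(1) ext(1), of "inverse r"] r by (auto simp: c1_def)
    obtain k where k: "0 < k" "incr x (s *\<^sub>R a) = k *\<^sub>R c0"
      using incr_half_line[OF x ext(1) s(1)] by (auto simp: c0_def)
    obtain l where l: "0 < l" "incr (x + b + b) (s *\<^sub>R a) = l *\<^sub>R c2"
      using incr_half_line[OF xb(2) ext(1) s(1)] by (auto simp: c2_def)
    have z: "x + s *\<^sub>R a \<in> U"
      using x ext s by (auto intro!: U_add scaleR_nonneg_nonneg simp: extreme_vector_nonneg)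
    obtain j where j: "0 < j" "incr (x + s *\<^sub>R a + b) b = j *\<^sub>R incr (x + s *\<^sub>R a) b"
      using incr_shift_parallel[OF z ext(2)] by (auto simp: parallel_def)
    \<comment> \<open>The position of \<open>f (x + s *\<^sub>R a + b)\<close> on the segment
      between the images of its two neighbours in direction \<open>b\<close>.\<close>
    define \<mu> where "\<mu> = inverse (1 + j)"
    have \<mu>: "0 < \<mu>" "\<mu> < 1" using j by (auto simp: \<mu>_def field_simps)
    have "incr (x + s *\<^sub>R a) (b + b) = (1 + j) *\<^sub>R incr (x + s *\<^sub>R a) b"
      using j by (simp add: incr_add scaleR_add_left)
    then have mid: "incr (x + s *\<^sub>R a) b = \<mu> *\<^sub>R incr (x + s *\<^sub>R a) (b + b)"
      using j by (simp add: \<mu>_def)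
    have 1: "k *\<^sub>R c0 + incr (x + s *\<^sub>R a) b = incr x b + inverse r *\<^sub>R c1"
      using s(2) k(2) by (simp add: incr_def algebra_simps flip: s(2) k(2))
    have 2: "k *\<^sub>R c0 + incr (x + s *\<^sub>R a) (b + b) = y + l *\<^sub>R c2"
      unfolding y_def by (simp add: incr_def algebra_simps flip: k(2) l(2))
    have "incr x b + inverse r *\<^sub>R c1 = k *\<^sub>R c0 + \<mu> *\<^sub>R (y + l *\<^sub>R c2 - k *\<^sub>R c0)"
    proof -
      have "incr x b + inverse r *\<^sub>R c1 = k *\<^sub>R c0 + \<mu> *\<^sub>R incr (x + s *\<^sub>R a) (b + b)"
        using 1 mid by simp
      moreover have "incr (x + s *\<^sub>R a) (b + b) = y + l *\<^sub>R c2 - k *\<^sub>R c0"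
        using 2 by (simp add: algebra_simps)
      ultimately show ?thesis by simp
    qed
    then have "r *\<^sub>R (incr x b + inverse r *\<^sub>R c1)
        = r *\<^sub>R (k *\<^sub>R c0 + \<mu> *\<^sub>R (y + l *\<^sub>R c2 - k *\<^sub>R c0))" by (rule arg_cong)
    then have eq: "r *\<^sub>R incr x b + c1
        = (r * (1 - \<mu>) * k) *\<^sub>R c0 + (r * \<mu> * l) *\<^sub>R c2 + (r * \<mu>) *\<^sub>R y"
      using r by (simp add: algebra_simps)
    define p where "p = r * (1 - \<mu>) * k"
    define q where "q = r * \<mu> * l"
    have eq': "r *\<^sub>R incr x b + c1 = p *\<^sub>R c0 + q *\<^sub>R c2 + (r * \<mu>) *\<^sub>R y"
      using eq by (simp add: p_def q_def)
    have pq: "0 \<le> p" "0 \<le> q" using r \<mu> k l by (auto simp: p_def q_def)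
    have nn: "0 \<le> p *\<^sub>R c0" "0 \<le> q *\<^sub>R c2" "0 \<le> (r * \<mu>) *\<^sub>R y" "0 \<le> r *\<^sub>R incr x b"
      using pq ec r \<mu> y0 bb by (auto intro!: scaleR_nonneg_nonneg simp: extreme_vector_nonneg)
    have rb: "r *\<^sub>R incr x b \<le> r *\<^sub>R y" using yb r by (intro scaleR_left_mono) auto
    have "(r * \<mu>) *\<^sub>R y \<le> r *\<^sub>R y" using r \<mu> y0 by (intro scaleR_right_mono) auto
    then have "p *\<^sub>R c0 + q *\<^sub>R c2 + (r * \<mu>) *\<^sub>R y \<le> p *\<^sub>R c0 + q *\<^sub>R c2 + r *\<^sub>R y"
      by (rule add_left_mono)
    moreover have "c1 \<le> r *\<^sub>R incr x b + c1" using nn by simp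
    ultimately have A: "c1 \<le> p *\<^sub>R c0 + q *\<^sub>R c2 + r *\<^sub>R y" using eq' by (metis order_trans)
    have "r *\<^sub>R incr x b + c1 \<le> c1 + r *\<^sub>R y" using rb by (simp add: add.commute)
    moreover have "p *\<^sub>R c0 \<le> p *\<^sub>R c0 + q *\<^sub>R c2 + (r * \<mu>) *\<^sub>R y"
      "q *\<^sub>R c2 \<le> p *\<^sub>R c0 + q *\<^sub>R c2 + (r * \<mu>) *\<^sub>R y"
      using nn by (simp_all add: add_increasing2 add_increasing)
    ultimately have "p *\<^sub>R c0 \<le> c1 + r *\<^sub>R y" "q *\<^sub>R c2 \<le> c1 + r *\<^sub>R y"
      using eq' by (metis order_trans)+
    then show ?thesis using A by blast
  qed
  then show ?thesis
    using extreme_approx_combination_parallel[OF ec y0] by (simp add: c0_def c1_def c2_def)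
qed

text \<open>If the first two lines in direction \<open>a\<close> are not parallel in the image,
  \<open>incr_three_lines\<close> makes the last two parallel. That determines the lines in
  direction \<open>b\<close>, and the parallelogram argument applies with \<open>a\<close> and
  \<open>b\<close> exchanged.\<close>

lemma incr_shift_extreme:
  assumes x: "x \<in> U" and ext: "extreme_vector a" "extreme_vector b" and npar: "\<not> parallel a b"
  shows "incr (x + b) a = incr x a"
proof (cases "parallel (incr (x + b) a) (incr x a)")
  case True
  then show ?thesis using incr_parallelogram assms by blast
next
  case False
  have npar': "\<not> parallel b a" using npar parallel_sym by blast
  have ab0: "0 \<le> a" "0 \<le> b" using ext by (auto simp: extreme_vector_nonneg)
  have U: "x + a \<in> U" "x + b \<in> U" using x ab0 by (auto intro: U_add)
  have "parallel (incr (x + b + b) a) (incr (x + b) a)"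
    using incr_three_lines[OF x ext] False parallel_sym by blast
  then have "incr (x + b + b) a = incr (x + b) a"
    using incr_parallelogram[OF U(2) ext npar] by blast
  \<comment> \<open>The same parallelogram read along its other pair of sides; since direction is
    constant along each \<open>b\<close> half-line, the parallelism moves back to the base points
    \<open>x + a\<close> and \<open>x\<close>.\<close>
  then have "incr (x + a + b) b = incr (x + b) b"
    by (simp add: incr_def algebra_simps)
  then have "parallel (incr (x + a) b) (incr x b)"
    using incr_shift_parallel[OF x ext(2)] incr_shift_parallel[OF U(1) ext(2)]
    by (metis parallel_sym parallel_trans)
  then have "incr (x + a) b = incr x b"
    using incr_parallelogram[OF x ext(2,1) npar'] by blast
  then show ?thesis by (simp add: incr_def algebra_simps)
qed

text \<open>An engaged \<open>e\<close> is a difference of sums of extreme vectors not parallel to it, so a shift by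
  a multiple of \<open>e\<close> can be replaced by shifts in directions not parallel to \<open>e\<close>.\<close>

lemma incr_shift_engaged:
  assumes x: "x \<in> U" and e: "engaged_vector e" and a: "extreme_vector a"
  shows "incr (x + a) e = incr x e"
proof (cases "parallel e a")
  case False
  then show ?thesis using x e a by (intro incr_shift_extreme) (auto simp: engaged_vector_def)
next
  case True
  have ext: "extreme_vector e" using e by (simp add: engaged_vector_def)
  \<comment> \<open>Admitting all nonnegative multiples and all base points makes \<open>P\<close>
    closed under sums and nonnegative scaling, hence \<open>Q = P - P\<close> a subspace.\<close>
  define P where
    "P = {v. 0 \<le> v \<and> (\<forall>t\<ge>0. \<forall>y\<in>U. incr (y + t *\<^sub>R v) e = incr y e)}"
  define Q where "Q = {p - n | p n. p \<in> P \<and> n \<in> P}"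
  have P0: "0 \<in> P" by (simp add: P_def)
  have Padd: "v + w \<in> P" if "v \<in> P" "w \<in> P" for v w
  proof -
    have "incr (y + t *\<^sub>R (v + w)) e = incr y e" if "0 \<le> t" "y \<in> U" for t y
    proof -
      have "y + t *\<^sub>R v \<in> U"
        using \<open>v \<in> P\<close> that by (auto simp: P_def intro!: U_add scaleR_nonneg_nonneg)
      then have "incr (y + t *\<^sub>R v + t *\<^sub>R w) e = incr (y + t *\<^sub>R v) e"
        using \<open>w \<in> P\<close> that by (auto simp: P_def)
      also have "\<dots> = incr y e" using \<open>v \<in> P\<close> that by (auto simp: P_def)
      finally show ?thesis by (simp add: scaleR_add_right add.assoc)
    qed
    then show ?thesis using that by (auto simp: P_def)
  qed
  have Pscale: "c *\<^sub>R v \<in> P" if "v \<in> P" "0 \<le> c" for c v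
    using that by (auto simp: P_def intro: scaleR_nonneg_nonneg)
  have "subspace Q"
    unfolding subspace_def
  proof (intro conjI ballI allI)
    show "0 \<in> Q" using P0 by (force simp: Q_def)
    fix v w assume "v \<in> Q" "w \<in> Q"
    then obtain p n p' n' where "v = p - n" "w = p' - n'" "p \<in> P" "n \<in> P" "p' \<in> P" "n' \<in> P"
      by (auto simp: Q_def)
    then show "v + w \<in> Q"
      unfolding Q_def by (intro CollectI exI[of _ "p + p'"] exI[of _ "n + n'"]) (auto intro: Padd)
  next
    fix c :: real and v assume "v \<in> Q"
    then obtain p n where v: "v = p - n" "p \<in> P" "n \<in> P" by (auto simp: Q_def)
    show "c *\<^sub>R v \<in> Q"
    proof (cases "0 \<le> c")
      case True
      then show ?thesis unfolding Q_def using v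
        by (intro CollectI exI[of _ "c *\<^sub>R p"] exI[of _ "c *\<^sub>R n"])
          (auto intro: Pscale simp: scaleR_diff_right)
    next
      case False
      then show ?thesis unfolding Q_def using v
        by (intro CollectI exI[of _ "(- c) *\<^sub>R n"] exI[of _ "(- c) *\<^sub>R p"])
          (auto intro!: Pscale[of _ "- c", simplified] simp: scaleR_diff_right)
    qed
  qed
  moreover have "\<Union> (extreme_rays - {ray e}) \<subseteq> Q"
  proof
    fix v assume "v \<in> \<Union> (extreme_rays - {ray e})"
    then obtain d where d: "extreme_vector d" "ray d \<noteq> ray e" "v \<in> ray d"
      by (auto simp: extreme_rays_def)
    obtain c where c: "0 \<le> c" "v = c *\<^sub>R d" using d by (auto simp: ray_def)
    have "d \<in> P"
      unfolding P_def
    proof (intro CollectI conjI allI impI ballI)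
      show "0 \<le> d" using d by (simp add: extreme_vector_nonneg)
      fix t :: real and y assume ty: "0 \<le> t" "y \<in> U"
      show "incr (y + t *\<^sub>R d) e = incr y e"
      proof (cases "t = 0")
        case False
        have "parallel (t *\<^sub>R d) d" using ty False by (intro parallelI[of t]) auto
        then have "\<not> parallel e (t *\<^sub>R d)"
          using d parallel_ray_eq parallel_trans by metis
        then show ?thesis
          using ty ext d False by (intro incr_shift_extreme extreme_vector_scaleR) auto
      qed auto
    qed
    then have "v \<in> P" using c Pscale by simp
    then show "v \<in> Q" unfolding Q_def using P0 by force
  qed
  ultimately have "span (\<Union> (extreme_rays - {ray e})) \<subseteq> Q" by (rule span_minimal[rotated])
  moreover have "e \<in> ray e" unfolding ray_def by (auto intro: exI[of _ 1])
  ultimately have "e \<in> Q" using e by (auto simp: engaged_vector_def engaged_rays_def)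
  then obtain p n where pn: "e = p - n" "p \<in> P" "n \<in> P" by (auto simp: Q_def)
  obtain t where t: "0 < t" "a = t *\<^sub>R e" using True parallel_sym by (auto simp: parallel_def)
  have "x + a \<in> U" using x a by (auto intro: U_add simp: extreme_vector_nonneg)
  \<comment> \<open>As \<open>a = t *\<^sub>R p - t *\<^sub>R n\<close>, a harmless further shift by
    \<open>t *\<^sub>R n\<close> turns the shift by \<open>a\<close> into the harmless shift by
    \<open>t *\<^sub>R p\<close>.\<close>
  then have "incr (x + a) e = incr (x + a + t *\<^sub>R n) e" using pn t by (auto simp: P_def)
  also have "x + a + t *\<^sub>R n = x + t *\<^sub>R p" by (simp add: t pn algebra_simps)
  also have "incr (x + t *\<^sub>R p) e = incr x e" using pn t x by (auto simp: P_def)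
  finally show ?thesis .
qed

end

section \<open>Engaged sums, suprema and infima\<close>

lemma engaged_sums_induct [consumes 1, case_names zero add]:
  assumes "v \<in> engaged_sums" and zero: "P 0"
    and add: "\<And>v e. \<lbrakk>v \<in> engaged_sums; P v; engaged_vector e\<rbrakk> \<Longrightarrow> P (v + e)"
  shows "P v"
proof -
  have "(\<Sum>i=1..n. r i) \<in> engaged_sums \<and> P (\<Sum>i=1..n. r i)"
    if "\<forall>i\<in>{1..n}. engaged_vector (r i)" for n and r :: "nat \<Rightarrow> 'a"
    using that
  proof (induction n)
    case 0
    then show ?case using zero by (force simp: engaged_sums_def)
  next
    case (Suc n)
    then have IH: "(\<Sum>i=1..n. r i) \<in> engaged_sums" "P (\<Sum>i=1..n. r i)" by auto
    have "(\<Sum>i=1..Suc n. r i) \<in> engaged_sums"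
      unfolding engaged_sums_def using Suc.prems by blast
    moreover have "P (\<Sum>i=1..Suc n. r i)" using add[OF IH, of "r (Suc n)"] Suc.prems by simp
    ultimately show ?case by blast
  qed
  then show ?thesis using assms(1) by (auto simp: engaged_sums_def)
qed

lemma engaged_sums_nonneg: "v \<in> engaged_sums \<Longrightarrow> 0 \<le> v"
  by (induction rule: engaged_sums_induct)
    (auto simp: engaged_vector_def extreme_vector_nonneg)

lemma isLub_UNIV_iff:
  "isLub UNIV S s \<longleftrightarrow> (\<forall>y\<in>S. y \<le> s) \<and> (\<forall>z. (\<forall>y\<in>S. y \<le> z) \<longrightarrow> s \<le> z)"
  by (auto simp: isLub_def setle_def setge_def leastP_def isUb_def)

lemma isGlb_UNIV_iff:
  "isGlb UNIV S s \<longleftrightarrow> (\<forall>y\<in>S. s \<le> y) \<and> (\<forall>z. (\<forall>y\<in>S. z \<le> y) \<longrightarrow> z \<le> s)"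
  by (auto simp: isGlb_def greatestP_def isLb_def setle_def setge_def)

context upper_iso
begin

lemma incr_shift_engaged_sum_vector:
  assumes "w \<in> engaged_sums" and "x \<in> U" and e: "engaged_vector e"
  shows "incr (x + w) e = incr x e"
  using assms(1,2)
proof (induction arbitrary: x rule: engaged_sums_induct)
  case (add w d)
  have d: "extreme_vector d" using add by (simp add: engaged_vector_def)
  have "x + w \<in> U" using add by (simp add: U_add engaged_sums_nonneg)
  then show ?case
    using incr_shift_engaged[OF _ e d, of "x + w"] add by (simp add: add.assoc)
qed simp

lemma incr_shift_engaged_sums:
  assumes "v \<in> engaged_sums" and "w \<in> engaged_sums" and "x \<in> U"
  shows "incr (x + w) v = incr x v"
  using assms
proof (induction rule: engaged_sums_induct)
  case (add v e)
  have "x + v \<in> U" using add by (simp add: U_add engaged_sums_nonneg)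
  then have "incr (x + v + w) e = incr (x + v) e"
    using incr_shift_engaged_sum_vector add by blast
  moreover have "x + v + w = x + w + v" by (simp add: ac_simps)
  ultimately show ?case using add by (simp add: incr_add)
qed simp

text \<open>Because \<open>S\<close> is nonempty, any upper bound \<open>z\<close> of its image lies
  above a point of \<open>V\<close>, hence in \<open>V\<close>; so \<open>g z\<close> exists as a
  competing upper bound of \<open>S\<close>.\<close>

lemma f_isLub:
  assumes S: "S \<noteq> {}" "S \<subseteq> U" and lub: "isLub UNIV S s"
  shows "isLub UNIV (f ` S) (f s)"
proof -
  have ub: "y \<le> s" if "y \<in> S" for y using lub that by (simp add: isLub_UNIV_iff)
  have least: "s \<le> z" if "\<And>y. y \<in> S \<Longrightarrow> y \<le> z" for z
    using lub that by (simp add: isLub_UNIV_iff)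
  have s: "s \<in> U" using S ub U_up by blast
  have "f s \<le> z" if z: "\<And>y. y \<in> S \<Longrightarrow> f y \<le> z" for z
  proof -
    have zV: "z \<in> V" using S z V_up f_in by blast
    have "s \<le> g z"
    proof (rule least)
      fix y assume "y \<in> S"
      then show "y \<le> g z" using z S zV g_mono f_in gf by (metis subsetD)
    qed
    then show ?thesis using f_mono[OF s g_in[OF zV]] fg[OF zV] by simp
  qed
  moreover have "f y \<le> f s" if "y \<in> S" for y using that S ub s by (auto intro!: f_mono)
  ultimately show ?thesis
    by (auto simp: isLub_UNIV_iff)
qed

end

lemma isLub_translate_iff:
  fixes S :: "'a::ordered_ab_group_add set"
  shows "isLub UNIV ((+) a ` S) (a + s) \<longleftrightarrow> isLub UNIV S s"
proof -
  have "(\<forall>z. (\<forall>y\<in>S. a + y \<le> z) \<longrightarrow> a + s \<le> z) \<longleftrightarrow> (\<forall>z. (\<forall>y\<in>S. y \<le> z) \<longrightarrow> s \<le> z)"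
    by (metis add.commute le_diff_eq add_le_cancel_left)
  then show ?thesis by (simp add: isLub_UNIV_iff)
qed

lemma isLub_unique_order: "isLub UNIV S s \<Longrightarrow> isLub UNIV S t \<Longrightarrow> s = (t::'a::order)"
  by (auto simp: isLub_UNIV_iff intro: antisym)

text \<open>A nontrivial space has no least element, hence no supremum of the empty family.\<close>

lemma inf_sup_hull_cases:
  fixes x :: "'a::ordered_real_vector"
  assumes "x \<in> inf_sup_hull W" and nontriv: "\<exists>z::'a. z \<noteq> 0"
  obtains S where "\<And>s. s \<in> S \<Longrightarrow> \<exists>E. E \<noteq> {} \<and> E \<subseteq> W \<and> isLub UNIV E s"
    and "isGlb UNIV S x"
proof -
  obtain A :: "'a set set" and B :: "'a set" and v s where
    v: "\<forall>\<alpha>\<in>A. \<forall>\<beta>\<in>B. v \<alpha> \<beta> \<in> W" and s: "\<forall>\<alpha>\<in>A. isLub UNIV (v \<alpha> ` B) (s \<alpha>)"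
    and x: "isGlb UNIV (s ` A) x"
    using assms(1) unfolding inf_sup_hull_def by blast
  have B: "B \<noteq> {}" if "\<alpha> \<in> A" for \<alpha>
  proof
    assume "B = {}"
    then have least: "s \<alpha> \<le> z" for z :: 'a using s that by (auto simp: isLub_UNIV_iff)
    \<comment> \<open>A least element is nonnegative by comparison with its double, so every vector
      is nonnegative, and so is its negative.\<close>
    have "s \<alpha> \<le> s \<alpha> + s \<alpha>" by (rule least)
    then have "0 \<le> z" for z :: 'a using least[of z] by (meson le_add_same_cancel1 order_trans)
    then have "z = 0" for z :: 'a by (metis antisym neg_0_le_iff_le)
    then show False using nontriv by blast
  qed
  show ?thesis
  proof (rule that)
    show "isGlb UNIV (s ` A) x" by (rule x)
    fix t assume "t \<in> s ` A"
    then obtain \<alpha> where \<alpha>: "\<alpha> \<in> A" "t = s \<alpha>" by blast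
    show "\<exists>E. E \<noteq> {} \<and> E \<subseteq> W \<and> isLub UNIV E t"
      using \<alpha> v s B by (intro exI[of _ "v \<alpha> ` B"]) auto
  qed
qed

section \<open>Increments do not depend on the base point\<close>

context upper_iso
begin

text \<open>Suprema commute with translations and with \<open>f\<close>, so \<open>incr z s\<close>
  is the supremum of the increments over \<open>E\<close> and is determined by them.\<close>

lemma incr_lub_congI:
  assumes x: "x \<in> U" "y \<in> U" and E: "E \<noteq> {}" "\<And>u. u \<in> E \<Longrightarrow> 0 \<le> u" and s: "isLub UNIV E s"
    and eq: "\<And>u. u \<in> E \<Longrightarrow> incr x u = incr y u"
  shows "incr x s = incr y s"
proof -
  have "isLub UNIV (incr z ` E) (incr z s)" if z: "z \<in> U" for z
  proof -
    have "isLub UNIV (f ` (+) z ` E) (f (z + s))"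
      using E z s by (intro f_isLub) (auto simp: isLub_translate_iff intro: U_add)
    moreover have "f ` (+) z ` E = (+) (f z) ` incr z ` E" by (simp add: image_image f_add)
    ultimately show ?thesis by (simp add: f_add isLub_translate_iff)
  qed
  moreover have "incr x ` E = incr y ` E" using eq by (intro image_cong refl)
  ultimately show ?thesis using x isLub_unique_order by metis
qed

text \<open>Infima in \<open>V\<close> need not be infima in the whole space; but the only lower bounds
  tested here are of the form \<open>f x + w\<close> with \<open>0 \<le> w\<close>, and these do lie in \<open>V\<close>.\<close>

lemma incr_glb_greatest:
  assumes x: "x \<in> U" and S: "\<And>s. s \<in> S \<Longrightarrow> 0 \<le> s" "isGlb UNIV S c"
    and w: "0 \<le> w" "\<And>s. s \<in> S \<Longrightarrow> w \<le> incr x s"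
  shows "w \<le> incr x c"
proof -
  have greatest: "z \<le> c" if "\<And>s. s \<in> S \<Longrightarrow> z \<le> s" for z
    using S(2) that by (simp add: isGlb_UNIV_iff)
  have c: "0 \<le> c" using S(1) by (rule greatest)
  have wV: "f x + w \<in> V" using V_up[OF f_in[OF x]] w by simp
  have "g (f x + w) - x \<le> c"
  proof (rule greatest)
    fix s assume s: "s \<in> S"
    have "f x + w \<le> f (x + s)" using w s by (simp add: f_add)
    then have "g (f x + w) \<le> x + s" using g_mono[OF wV f_in] gf U_add[OF x S(1)[OF s]] by metis
    then show "g (f x + w) - x \<le> s" by (simp add: algebra_simps)
  qed
  then have "g (f x + w) \<le> x + c" by (simp add: algebra_simps)
  then have "f x + w \<le> f (x + c)" using f_mono[OF g_in[OF wV] U_add[OF x c]] fg[OF wV] by simp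
  then show ?thesis by (simp add: f_add)
qed

text \<open>The claim is symmetric in \<open>v\<close> and \<open>c\<close>, so it suffices that
  \<open>incr x c\<close> is unchanged by the shift \<open>v\<close>. This holds for engaged sums,
  passes to their suprema \<open>s\<close>, and then to the infimum \<open>c\<close>.\<close>

lemma incr_shift_hull:
  assumes v: "v \<in> engaged_sums" and c: "c \<in> inf_sup_hull (engaged_sums :: 'a set)" "0 \<le> c"
    and nontriv: "\<exists>z::'a. z \<noteq> 0" and x: "x \<in> U"
  shows "incr (x + c) v = incr x v"
proof -
  have v0: "0 \<le> v" using v by (rule engaged_sums_nonneg)
  obtain S where S: "\<And>s. s \<in> S \<Longrightarrow> \<exists>E. E \<noteq> {} \<and> E \<subseteq> (engaged_sums :: 'a set) \<and> isLub UNIV E s"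
    and glb: "isGlb UNIV S c"
    using inf_sup_hull_cases[OF c(1) nontriv] by metis
  have cS: "c \<le> s" if "s \<in> S" for s
    using glb that by (simp add: isGlb_UNIV_iff)
  have S0: "0 \<le> s" if "s \<in> S" for s using cS[OF that] c by simp
  have xv: "x + v \<in> U" and xc: "x + c \<in> U" using x v0 c by (auto intro: U_add)
  have eq: "incr (x + v) s = incr x s" if s: "s \<in> S" for s
  proof -
    obtain E where E: "E \<noteq> {}" "E \<subseteq> engaged_sums" "isLub UNIV E s" using S[OF s] by blast
    show ?thesis
    proof (rule incr_lub_congI[OF xv x E(1) _ E(3)])
      fix u assume u: "u \<in> E"
      then show "0 \<le> u" using E engaged_sums_nonneg by blast
      show "incr (x + v) u = incr x u"
        using incr_shift_engaged_sums[of u v x] u E v x by blast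
    qed
  qed
  \<comment> \<open>By \<open>eq\<close>, \<open>incr x c\<close> is a nonnegative lower bound of
    the increments from \<open>x + v\<close>; the reverse inequality exchanges the base
    points.\<close>
  have "incr x c \<le> incr (x + v) c"
    using eq cS c x by (intro incr_glb_greatest[OF xv S0 glb]) (auto intro: incr_nonneg incr_mono)
  moreover have "incr (x + v) c \<le> incr x c"
    using cS c xv by (intro incr_glb_greatest[OF x S0 glb]) (auto intro: incr_nonneg incr_mono simp flip: eq)
  ultimately have "incr (x + v) c = incr x c" by (rule antisym[rotated])
  then show ?thesis by (simp add: incr_def algebra_simps)
qed

text \<open>Two base points are joined through a common upper bound \<open>z\<close>:
  \<open>z - x\<close> and \<open>z - y\<close> lie in the cone, hence in the hull, and such shifts
  preserve increments by engaged sums. Suprema and infima then reach all of the cone.\<close>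

lemma incr_base_independent:
  assumes dir: "directed_order TYPE('a)" and hull: "{0::'a..} = inf_sup_hull engaged_sums"
    and nontriv: "\<exists>z::'a. z \<noteq> 0" and x: "x \<in> U" and y: "y \<in> U" and c: "0 \<le> c"
  shows "incr x c = incr y c"
proof -
  have eng: "incr x v = incr y v" if v: "v \<in> engaged_sums" for v
  proof -
    obtain z where z: "x \<le> z" "y \<le> z" using dir by (auto simp: directed_order_def)
    have "z - x \<in> inf_sup_hull engaged_sums" "z - y \<in> inf_sup_hull engaged_sums"
      using z by (simp_all flip: hull)
    then have "incr (x + (z - x)) v = incr x v" and "incr (y + (z - y)) v = incr y v"
      using z by (intro incr_shift_hull[OF v _ _ nontriv] x y; simp)+
    then show ?thesis by simp
  qed
  have "c \<in> inf_sup_hull (engaged_sums :: 'a set)" using c by (simp flip: hull)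
  then obtain S where S: "\<And>s. s \<in> S \<Longrightarrow> \<exists>E. E \<noteq> {} \<and> E \<subseteq> (engaged_sums :: 'a set) \<and> isLub UNIV E s"
    and glb: "isGlb UNIV S c"
    using inf_sup_hull_cases[OF _ nontriv] by metis
  have cS: "c \<le> s" if "s \<in> S" for s
    using glb that by (simp add: isGlb_UNIV_iff)
  have S0: "0 \<le> s" if "s \<in> S" for s using cS[OF that] c by simp
  have eq: "incr x s = incr y s" if s: "s \<in> S" for s
  proof -
    obtain E where E: "E \<noteq> {}" "E \<subseteq> engaged_sums" "isLub UNIV E s" using S[OF s] by blast
    then show ?thesis
      using eng engaged_sums_nonneg by (intro incr_lub_congI[OF x y E(1) _ E(3)]) blast+
  qed
  have "incr x c \<le> incr y c"
    using cS c x by (intro incr_glb_greatest[OF y S0 glb]) (auto intro: incr_nonneg incr_mono simp flip: eq)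
  moreover have "incr y c \<le> incr x c"
    using cS c y by (intro incr_glb_greatest[OF x S0 glb]) (auto intro: incr_nonneg incr_mono simp: eq)
  ultimately show ?thesis by (rule antisym)
qed

lemma affine:
  assumes dir: "directed_order TYPE('a)" and hull: "{0::'a..} = inf_sup_hull engaged_sums"
    and nontriv: "\<exists>z::'a. z \<noteq> 0" and a: "a \<in> U"
  shows "\<exists>T c. linear T \<and> (\<forall>x\<in>U. f x = T x + c)"
proof -
  note indep = incr_base_independent[OF dir hull nontriv]
  have "incr a (v + w) = incr a v + incr a w" if "0 \<le> v" "0 \<le> w" for v w
    using indep[OF U_add[OF a that(1)] a that(2)] by (simp add: incr_add)
  then obtain T where T: "linear T" "\<And>v. 0 \<le> v \<Longrightarrow> T v = incr a v"
    using additive_cone_map_extends[OF dir, of "incr a"] incr_nonneg[OF a] by metis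
  have "f x = T x + (f a - T a)" if x: "x \<in> U" for x
  proof -
    \<comment> \<open>Since \<open>x\<close> and \<open>a\<close> may be incomparable,
      \<open>f x\<close> and \<open>f a\<close> are compared by climbing from each to the same
      \<open>z\<close>.\<close>
    obtain z where z: "a \<le> z" "x \<le> z" using dir by (auto simp: directed_order_def)
    have "f z = f a + T (z - a)" using T(2)[of "z - a"] z by (simp add: incr_def)
    moreover have "f z = f x + T (z - x)"
      using T(2)[of "z - x"] indep[OF a x, of "z - x"] z by (simp add: incr_def)
    ultimately show ?thesis by (simp add: linear_diff[OF T(1)] algebra_simps)
  qed
  then show ?thesis using T(1) by blast
qed

end

theorem theorem1p1:
  fixes U :: "'a::archimedean_ordered_real_vector set"
    and V :: "'b::archimedean_ordered_real_vector set"
    and f :: "'a \<Rightarrow> 'b"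
  assumes "upper_set U" and "upper_set V"
    and "order_isomorphism_on U V f"
    and "directed_order TYPE('a)"
    and "{0::'a..} = inf_sup_hull engaged_sums"
  shows "is_affine_on U f"
proof -
  have bij: "bij_betw f U V" and mono: "mono_on U f" "mono_on V (inv_into U f)"
    using assms(3) by (auto simp: order_isomorphism_on_def)
  interpret upper_iso U V f "inv_into U f"
  proof
    show "inv_into U f y \<in> U" if "y \<in> V" for y
      using bij that by (metis bij_betw_imp_surj_on inv_into_into)
    show "f x \<in> V" if "x \<in> U" for x using bij that by (rule bij_betw_apply)
    show "inv_into U f (f x) = x" if "x \<in> U" for x using bij that by (rule bij_betw_inv_into_left)
    show "f (inv_into U f y) = y" if "y \<in> V" for y
      using bij that by (rule bij_betw_inv_into_right)
  qed (use assms(1,2) in \<open>auto intro: mono_onD[OF mono(1)] mono_onD[OF mono(2)]\<close>)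
  have "\<exists>T c. linear T \<and> (\<forall>x\<in>U. f x = T x + c)"
  \<comment> \<open>The zero space, where even the empty family has a supremum, and an empty
    \<open>U\<close>, which has no base point, are settled by a constant map.\<close>
  proof (cases "(\<exists>z::'a. z \<noteq> 0) \<and> U \<noteq> {}")
    case True
    then show ?thesis using affine[OF assms(4,5)] by blast
  next
    case False
    have "linear (\<lambda>x::'a. 0::'b)" by (simp add: linear_iff)
    moreover have "\<forall>x\<in>U. f x = 0 + f 0" using False by (metis add_0 empty_iff)
    ultimately show ?thesis by blast
  qed
  then obtain T c where T: "linear T" "\<And>x. x \<in> U \<Longrightarrow> f x = T x + c" by blast
  then show ?thesis
    unfolding is_affine_on_def affine_map_on_def by (intro exI[of _ "\<lambda>x. T x + c"]) auto
qed

end
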